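(* Let $d \geq 2$ be an integer and $p \in (0,1)$. There exists a Zariski-dense probability measure $\mu$ on $\mathrm{SL}_d(\mathbb{R})$ with finite $L^p$-moment such that the associated random walk on $X=\mathrm{SL}_d(\mathbb{R})/\mathrm{SL}_d(\mathbb{Z})$ is not recurrent in law on $X$.
   Context: A probability measure $\mu$ on $\mathrm{SL}_d(\mathbb{R})$ is called Zariski-dense if the semigroup generated by the support of $\mu$ is Zariski-dense in $\mathrm{SL}_d(\mathbb{R})$. It has finite $L^p$-moment if $\int (\log \|g\|)^p\, d\mu(g)<\infty$, where $\|\cdot\|$ is the operator norm induced by the Euclidean norm on $\mathbb{R}^d$. The space $X$ carries the quotient topology and the left-multiplication action of $\mathrm{SL}_d(\mathbb{R})$. $\mu^{\ast n}$ is the $n$-fold convolution of $\mu$, and $\mu^{\ast n}\ast\delta_x$ is the push-forward of $\mu^{\ast n}$ under $g\mapsto gx$ (the $n$-th step distribution of the $\mu$-random walk on $X$ started at $x$, i.e. of the Markov chain on $X$ with transition probabilities $y\mapsto\mu\ast\delta_y$). The random walk on $X$ induced by $\mu$ is recurrent in law on $X$ if for every $\varepsilon>0$ and $x \in X$ there exist a compact $M \subseteq X$ and $n_0 \in \mathbb{N}$ such that $\mu^{\ast n}\ast \delta_x(M)>1-\varepsilon$ for every $n \geq n_0$. *)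

theory Defs
  imports "HOL-Probability.Probability" "HOL-Algebra.Left_Coset"
begin

section \<open>The group and its homogeneous space\<close>

definition SL :: "(real^'n^'n) monoid" where
  "SL = \<lparr>carrier = {A. det A = 1}, mult = (**), one = mat 1\<rparr>"

definition SLZ :: "(real^'n^'n) set" where
  "SLZ = {A \<in> carrier SL. \<forall>i j. A $ i $ j \<in> \<int>}"

definition SL_borel :: "(real^'n^'n) measure" where
  "SL_borel = restrict_space borel (carrier SL)"

text \<open>Points of the homogeneous space are left cosets, i.e. sets of matrices; the left-multiplication action of a
  matrix \<open>g\<close> on a point \<open>x\<close> is then \<open>g <#\<^bsub>SL\<^esub> x\<close>.\<close>

definition homspace :: "(real^'n^'n) set set" where
  "homspace = lcosets\<^bsub>SL\<^esub> SLZ"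

definition homspace_top :: "(real^'n^'n) set topology" where
  "homspace_top = topology (\<lambda>U. U \<subseteq> homspace \<and>
     openin (top_of_set (carrier SL)) {g \<in> carrier SL. g <#\<^bsub>SL\<^esub> SLZ \<in> U})"

definition homspace_borel :: "(real^'n^'n) set measure" where
  "homspace_borel = sigma homspace {U. openin homspace_top U}"


section \<open>Zariski density\<close>

text \<open>A real polynomial function on the vector space of matrices is a
  polynomial in the matrix entries.\<close>

definition zariski_closed_SL :: "(real^'n^'n) set \<Rightarrow> bool" where
  "zariski_closed_SL Z \<longleftrightarrow>
     (\<exists>F. (\<forall>f\<in>F. real_polynomial_function f) \<and> Z = {A \<in> carrier SL. \<forall>f\<in>F. f A = 0})"

definition zariski_dense_SL :: "(real^'n^'n) set \<Rightarrow> bool" where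
  "zariski_dense_SL S \<longleftrightarrow> (\<forall>Z. zariski_closed_SL Z \<and> S \<subseteq> Z \<longrightarrow> Z = carrier SL)"

inductive_set semigroup_generated :: "(real^'n^'n) set \<Rightarrow> (real^'n^'n) set"
  for S :: "(real^'n^'n) set" where
  gen: "A \<in> S \<Longrightarrow> A \<in> semigroup_generated S"
| mult: "A \<in> semigroup_generated S \<Longrightarrow> B \<in> semigroup_generated S
          \<Longrightarrow> A ** B \<in> semigroup_generated S"


section \<open>Probability measures on the group and their random walks\<close>

definition prob_measure_SL :: "(real^'n^'n) measure \<Rightarrow> bool" where
  "prob_measure_SL \<mu> \<longleftrightarrow> prob_space \<mu> \<and> sets \<mu> = sets SL_borel"

definition msupport :: "(real^'n^'n) measure \<Rightarrow> (real^'n^'n) set" where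
  "msupport \<mu> = {A \<in> carrier SL.
     \<forall>U. openin (top_of_set (carrier SL)) U \<and> A \<in> U \<longrightarrow> emeasure \<mu> U > 0}"

definition zariski_dense_measure :: "(real^'n^'n) measure \<Rightarrow> bool" where
  "zariski_dense_measure \<mu> \<longleftrightarrow> zariski_dense_SL (semigroup_generated (msupport \<mu>))"

text \<open>On the group the operator norm is at least 1, so the base of the power is nonnegative.\<close>

definition finite_Lp_moment :: "real \<Rightarrow> (real^'n^'n) measure \<Rightarrow> bool" where
  "finite_Lp_moment p \<mu> \<longleftrightarrow> (\<integral>\<^sup>+ g. ennreal (ln (onorm ((*v) g)) powr p) \<partial>\<mu>) < \<infinity>"

text \<open>The library's convolution is for additively written groups.\<close>

definition mconv :: "(real^'n^'n) measure \<Rightarrow> (real^'n^'n) measure \<Rightarrow> (real^'n^'n) measure" where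
  "mconv \<mu> \<nu> = distr (\<mu> \<Otimes>\<^sub>M \<nu>) SL_borel (\<lambda>(g, h). g ** h)"

primrec mconv_pow :: "(real^'n^'n) measure \<Rightarrow> nat \<Rightarrow> (real^'n^'n) measure" where
  "mconv_pow \<mu> 0 = return SL_borel (mat 1)"
| "mconv_pow \<mu> (Suc n) = mconv \<mu> (mconv_pow \<mu> n)"

definition walk_law :: "(real^'n^'n) measure \<Rightarrow> nat \<Rightarrow> (real^'n^'n) set \<Rightarrow> (real^'n^'n) set measure"
  where "walk_law \<mu> n x = distr (mconv_pow \<mu> n) homspace_borel (\<lambda>g. g <#\<^bsub>SL\<^esub> x)"

definition recurrent_in_law :: "(real^'n^'n) measure \<Rightarrow> bool" where
  "recurrent_in_law \<mu> \<longleftrightarrow>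
     (\<forall>\<epsilon>>0. \<forall>x\<in>homspace. \<exists>M n0. compactin homspace_top M \<and> (\<forall>n\<ge>n0. measure (walk_law \<mu> n x) M > 1 - \<epsilon>))"


section \<open>Well-definedness\<close>

text \<open>\<open>topology\<close> and \<open>distr\<close> are only meaningful for genuine topologies and measurable maps.\<close>

lemma carrier_SL: "carrier SL = {A. det A = 1}"
  and mult_SL [simp]: "A \<otimes>\<^bsub>SL\<^esub> B = A ** B"
  and one_SL [simp]: "\<one>\<^bsub>SL\<^esub> = mat 1"
  by (simp_all add: SL_def)

lemma group_SL: "group (SL :: (real^'n^'n) monoid)"
proof (rule groupI)
  fix A :: "real^'n^'n" assume "A \<in> carrier SL"
  then have d: "det A = 1" by (simp add: carrier_SL)
  then obtain B where B: "B ** A = mat 1"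
    using invertible_det_nz[of A] invertible_left_inverse[of A] by auto
  then have "det B = 1" by (metis d det_I det_mul mult.right_neutral)
  with B show "\<exists>B\<in>carrier SL. B \<otimes>\<^bsub>SL\<^esub> A = \<one>\<^bsub>SL\<^esub>"
    by (auto simp: carrier_SL)
qed (auto simp: carrier_SL det_mul matrix_mul_assoc)

lemma openin_homspace_top:
  fixes U :: "(real^'n^'n) set set"
  shows "openin homspace_top U \<longleftrightarrow> U \<subseteq> homspace \<and>
     openin (top_of_set (carrier SL)) {g \<in> carrier SL. g <#\<^bsub>SL\<^esub> SLZ \<in> U}"
proof -
  let ?P = "\<lambda>U :: (real^'n^'n) set set. {g \<in> carrier SL. g <#\<^bsub>SL\<^esub> SLZ \<in> U}"
  have "istopology (\<lambda>U :: (real^'n^'n) set set. U \<subseteq> homspace \<and> openin (top_of_set (carrier SL)) (?P U))"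
  proof -
    have I: "?P (S \<inter> T) = ?P S \<inter> ?P T" and U: "?P (\<Union>K) = \<Union>(?P ` K)" for S T K
      by auto
    show ?thesis
      unfolding istopology_def I U by (auto intro!: openin_Int openin_Union)
  qed
  then show ?thesis by (simp add: homspace_top_def topology_inverse')
qed

lemma coset_in_homspace: "g \<in> carrier SL \<Longrightarrow> g <#\<^bsub>SL\<^esub> SLZ \<in> homspace"
  by (auto simp: homspace_def LCOSETS_def)

lemma topspace_homspace_top [simp]: "topspace homspace_top = (homspace :: (real^'n^'n) set set)"
proof -
  have "{g \<in> carrier SL. g <#\<^bsub>SL\<^esub> SLZ \<in> homspace} = (carrier SL :: (real^'n^'n) set)"
    using coset_in_homspace by blast
  then have "openin homspace_top (homspace :: (real^'n^'n) set set)"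
    by (simp add: openin_homspace_top)
  then show ?thesis using openin_subset openin_homspace_top openin_topspace by blast
qed

lemma quotient_map_homspace_top:
  "quotient_map (top_of_set (carrier SL)) homspace_top (\<lambda>g. g <#\<^bsub>SL\<^esub> SLZ)"
  unfolding quotient_map_def
  by (auto simp: openin_homspace_top homspace_def LCOSETS_def)

lemma space_SL_borel [simp]: "space SL_borel = carrier SL"
  by (simp add: SL_borel_def space_restrict_space)

lemma space_homspace_borel [simp]: "space homspace_borel = homspace"
  and sets_homspace_borel: "sets homspace_borel = sigma_sets homspace {U. openin homspace_top U}"
  using openin_homspace_top by (auto simp: homspace_borel_def space_measure_of_conv sets_measure_of_conv)

lemma measurable_SL_mult:
  "(\<lambda>(g, h). g ** h) \<in> measurable (SL_borel \<Otimes>\<^sub>M SL_borel) (SL_borel :: (real^'n^'n) measure)"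
proof -
  have id: "(\<lambda>g. g) \<in> measurable (SL_borel :: (real^'n^'n) measure) borel"
    unfolding SL_borel_def by (rule measurable_restrict_space1) simp
  have "continuous_on UNIV (\<lambda>p. fst p ** snd p :: real^'n^'n)"
    unfolding matrix_matrix_mult_def by (intro continuous_intros)
  then have c: "(\<lambda>p. fst p ** snd p :: real^'n^'n) \<in> borel_measurable borel"
    by (rule borel_measurable_continuous_onI)
  have "(\<lambda>p. (fst p, snd p)) \<in> borel_measurable ((SL_borel :: (real^'n^'n) measure) \<Otimes>\<^sub>M (SL_borel :: (real^'n^'n) measure))"
    unfolding borel_prod[symmetric]
    by (rule measurable_Pair[OF measurable_compose[OF measurable_fst id]
          measurable_compose[OF measurable_snd id]])
  from measurable_compose[OF this c]
  have "(\<lambda>p. fst p ** snd p) \<in> borel_measurable ((SL_borel :: (real^'n^'n) measure) \<Otimes>\<^sub>M (SL_borel :: (real^'n^'n) measure))"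
    by (simp only: fst_conv snd_conv)
  then show ?thesis
    unfolding SL_borel_def case_prod_beta
    by (intro measurable_restrict_space2)
       (auto simp: space_pair_measure space_restrict_space carrier_SL det_mul)
qed

lemma measurable_orbit_map:
  assumes "x \<in> homspace"
  shows "(\<lambda>g. g <#\<^bsub>SL\<^esub> x) \<in> measurable SL_borel (homspace_borel :: (real^'n^'n) set measure)"
proof -
  from assms obtain h :: "real^'n^'n" where h: "h \<in> carrier SL" and x: "x = h <#\<^bsub>SL\<^esub> SLZ"
    by (auto simp: homspace_def LCOSETS_def)
  have act: "g <#\<^bsub>SL\<^esub> x = (g ** h) <#\<^bsub>SL\<^esub> SLZ" for g
    by (auto simp: x l_coset_def matrix_mul_assoc)
  have gh: "g ** h \<in> carrier SL" if "g \<in> carrier SL" for g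
    using that h by (simp add: carrier_SL det_mul)
  show ?thesis
    unfolding homspace_borel_def
  proof (rule measurable_measure_of)
    show "{U. openin homspace_top U} \<subseteq> Pow homspace" using openin_homspace_top by blast
    show "(\<lambda>g. g <#\<^bsub>SL\<^esub> x) \<in> space SL_borel \<rightarrow> homspace" using gh coset_in_homspace by (auto simp: act)
    fix U :: "(real^'n^'n) set set" assume "U \<in> {U. openin homspace_top U}"
    then have "openin (top_of_set (carrier SL)) {g \<in> carrier SL. g <#\<^bsub>SL\<^esub> SLZ \<in> U}"
      by (simp add: openin_homspace_top)
    then obtain T where T: "open T" "{g \<in> carrier SL. g <#\<^bsub>SL\<^esub> SLZ \<in> U} = carrier SL \<inter> T"
      by (auto simp: openin_open)
    have "continuous_on UNIV (\<lambda>g :: real^'n^'n. g ** h)"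
      unfolding matrix_matrix_mult_def by (intro continuous_intros)
    then have "open ((\<lambda>g :: real^'n^'n. g ** h) -` T)" using T(1) by (simp add: open_vimage)
    moreover have "(\<lambda>g. g <#\<^bsub>SL\<^esub> x) -` U \<inter> space SL_borel = (\<lambda>g :: real^'n^'n. g ** h) -` T \<inter> carrier SL"
    proof -
      have "g <#\<^bsub>SL\<^esub> x \<in> U \<longleftrightarrow> g ** h \<in> T" if "g \<in> carrier SL" for g
        using T(2) gh[OF that] unfolding act by blast
      then show ?thesis unfolding space_SL_borel by blast
    qed
    ultimately show "(\<lambda>g. g <#\<^bsub>SL\<^esub> x) -` U \<inter> space SL_borel \<in> sets SL_borel"
      unfolding SL_borel_def sets_restrict_space by (metis Int_commute borel_open imageI)
  qed
qed

end

theory Submission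
  imports Defs
begin

text \<open>The measure \<open>\<mu>\<close> is a sum of atoms \<open>s k\<close> with rapidly decreasing masses. The even-numbered atoms
  enumerate \<open>SL\<^sub>d(\<rat>)\<close>, which is dense, so the support is the whole group. For odd \<open>k\<close> the atom is
  \<open>diag(1/N, N, 1, \<dots>, 1)\<close>. Let \<open>C\<close> bound the norms and the denominators of all atoms with index below \<open>k\<close>.
  After \<open>n \<approx> 1/\<mu>{s j. j \<ge> k}\<close> steps, with probability at least \<open>1/8\<close> the walk from \<open>\<int>\<^sup>d\<close> has used \<open>s k\<close> exactly
  once and otherwise only smaller atoms. Before the jump the lattice contains \<open>D e\<^sub>1\<close> for some
  \<open>0 < D \<le> C\<^sup>n\<close>, because all atoms are rational; the jump shrinks this vector by \<open>N\<close>, and the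
  remaining steps lengthen it by at most a power of \<open>C\<close>. For \<open>N = C\<^bsup>n+1\<^esup>\<close> the lattice therefore has a
  vector of length at most \<open>1/C\<close> and lies far out in the cusp. The jump contributes about
  \<open>(n ln C)\<^sup>p/n\<close> to the moment, and since \<open>p < 1\<close> this is as small as we like if \<open>n\<close> is chosen large after \<open>C\<close>.\<close>

section \<open>Rational matrices\<close>

definition int_vecs :: "(real^'n) set" where
  "int_vecs = {v. \<forall>i. v $ i \<in> \<int>}"

definition SLQ :: "(real^'n^'n) set" where
  "SLQ = {A \<in> carrier SL. \<forall>i j. A $ i $ j \<in> \<rat>}"

text \<open>\<open>D \<int>\<^sup>d \<subseteq> A \<int>\<^sup>d\<close>\<close>

definition clears_denom :: "real \<Rightarrow> real^'n^'n \<Rightarrow> bool" where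
  "clears_denom D A \<longleftrightarrow> (\<forall>u\<in>int_vecs. \<exists>v\<in>int_vecs. A *v v = D *\<^sub>R u)"

lemma clears_denom_mat_1: "clears_denom 1 (mat 1)"
  by (auto simp: clears_denom_def)

text \<open>\<open>B\<close> maps \<int>^d onto a set containing E \<int>^d, so
  \<open>A ** B\<close> maps it onto a set containing E A \<int>^d and hence D E \<int>^d:
  denominators multiply along a product.\<close>

lemma clears_denom_mult:
  assumes "clears_denom D A" "clears_denom E B"
  shows "clears_denom (D * E) (A ** B)"
  unfolding clears_denom_def
proof
  fix u :: "real^'a" assume "u \<in> int_vecs"
  then obtain v where v: "v \<in> int_vecs" "A *v v = D *\<^sub>R u"
    using assms(1) by (auto simp: clears_denom_def)
  then obtain w where "w \<in> int_vecs" "B *v w = E *\<^sub>R v"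
    using assms(2) by (auto simp: clears_denom_def)
  then show "\<exists>w\<in>int_vecs. (A ** B) *v w = (D * E) *\<^sub>R u"
    by (intro bexI[of _ w]) (auto simp: v matrix_vector_mul_assoc[symmetric] matrix_vector_mult_scaleR)
qed

lemma det_Ints:
  fixes A :: "real^'n^'n"
  assumes "\<And>i j. A $ i $ j \<in> \<int>"
  shows "det A \<in> \<int>"
  unfolding det_def by (intro Ints_sum Ints_mult Ints_prod assms) auto

lemma det_Rats:
  fixes A :: "real^'n^'n"
  assumes "\<And>i j. A $ i $ j \<in> \<rat>"
  shows "det A \<in> \<rat>"
  unfolding det_def by (intro Rats_sum Rats_mult Rats_prod assms) auto

lemma common_denominator:
  fixes X :: "real set"
  assumes "finite X" "X \<subseteq> \<rat>"
  shows "\<exists>q::nat. q > 0 \<and> (\<forall>x\<in>X. of_nat q * x \<in> \<int>)"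
  using assms
proof (induction X rule: finite_induct)
  case empty
  then show ?case by auto
next
  case (insert x X)
  then obtain q :: nat where q: "q > 0" "\<forall>x\<in>X. of_nat q * x \<in> \<int>" by auto
  from insert.prems have "x \<in> \<rat>" by auto
  then obtain a b where b: "b > 0" "x = of_int a / of_int b"
    by (metis Rats_cases')
  then have x: "of_nat (nat b) * x = of_int a" by simp
  have "of_nat (q * nat b) * y \<in> \<int>" if "y \<in> insert x X" for y
  proof (cases "y = x")
    case True
    have "of_nat (q * nat b) * y = of_nat q * of_int a"
      unfolding True x[symmetric] by simp
    then show ?thesis by (metis Ints_mult Ints_of_int Ints_of_nat)
  next
    case False
    have "of_nat (q * nat b) * y = of_nat (nat b) * (of_nat q * y)" by simp
    also have "\<dots> \<in> \<int>" using q(2) that False by (metis Ints_mult Ints_of_nat insertE)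
    finally show ?thesis .
  qed
  with q(1) b(1) show ?case by (intro exI[of _ "q * nat b"]) auto
qed

text \<open>By Cramer's rule, the \<open>d\<close>-th power of a common denominator of the entries works.\<close>

lemma ex_clears_denom:
  fixes A :: "real^'n^'n"
  assumes "A \<in> SLQ"
  shows "\<exists>D::nat. D > 0 \<and> clears_denom (real D) A"
proof -
  have "finite (range (\<lambda>(i,j). A $ i $ j))" "range (\<lambda>(i,j). A $ i $ j) \<subseteq> \<rat>"
    using assms by (auto simp: SLQ_def)
  from common_denominator[OF this] obtain q :: nat
    where q: "q > 0" "\<And>i j. of_nat q * A $ i $ j \<in> \<int>" by fastforce
  have dA: "det A = 1" using assms by (simp add: SLQ_def carrier_SL)
  have "\<exists>v\<in>int_vecs. A *v v = real (q ^ CARD('n)) *\<^sub>R u" if u: "u \<in> int_vecs" for u :: "real^'n"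
  proof -
    let ?M = "\<lambda>k. \<chi> i j. if j = k then u $ i else A $ i $ j"
    define x where "x = (\<chi> k. det (?M k) / det A)"
    have x: "A *v x = u" using cramer[of A x u] dA by (simp add: x_def)
    have int: "real (q ^ CARD('n)) * det (?M k) \<in> \<int>" for k
    proof -
      \<comment> \<open>The power of \<open>q\<close> is spread over the rows of the Cramer matrix,
        one factor each. This clears the entries of \<open>A\<close> and keeps the integral column
        \<open>u\<close> integral.\<close>
      have "det (\<chi> i. real q *s (?M k $ i)) = (\<Prod>i\<in>(UNIV::'n set). real q) * det (?M k)"
        using det_rows_mul[of "\<lambda>_. real q" "\<lambda>i. ?M k $ i"] by (simp only: vec_nth_inverse)
      then have "real (q ^ CARD('n)) * det (?M k) = det (\<chi> i. real q *s (?M k $ i))" by simp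
      also have "\<dots> \<in> \<int>"
        using q(2) u by (intro det_Ints) (auto simp: int_vecs_def)
      finally show ?thesis .
    qed
    have "real (q ^ CARD('n)) *\<^sub>R x \<in> int_vecs"
      using int unfolding int_vecs_def x_def dA by (simp del: of_nat_power)
    then show ?thesis using x
      by (intro bexI[of _ "real (q ^ CARD('n)) *\<^sub>R x"]) (simp_all add: matrix_vector_mult_scaleR)
  qed
  with q(1) show ?thesis
    by (intro exI[of _ "q ^ CARD('n)"]) (auto simp: clears_denom_def)
qed

section \<open>Joint control of norms and denominators\<close>

lemma norm_le_onorm: "norm (A *v u) \<le> onorm ((*v) A) * norm u" for A :: "real^'n^'n"
  by (rule onorm) simp

text \<open>The two bounds serve the two phases of the walk: the denominator before the jump, the
  norm after it. Asking for some \<open>D \<le> C\<close> instead of \<open>D = C\<close> makes the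
  notion monotone in \<open>C\<close>, so that one constant serves finitely many atoms.\<close>

definition tame :: "real \<Rightarrow> real^'n^'n \<Rightarrow> bool" where
  "tame C A \<longleftrightarrow> (\<forall>u. norm (A *v u) \<le> C * norm u) \<and> (\<exists>D. 0 < D \<and> D \<le> C \<and> clears_denom D A)"

lemma tame_mono: "tame C A \<Longrightarrow> C \<le> C' \<Longrightarrow> tame C' A"
  unfolding tame_def by (meson mult_right_mono norm_ge_zero order_trans)

lemma ex_tame:
  assumes "A \<in> SLQ"
  shows "\<exists>C::nat. tame (real C) A"
proof -
  obtain D :: nat where D: "D > 0" "clears_denom (real D) A" using ex_clears_denom[OF assms] by auto
  obtain m :: nat where m: "onorm ((*v) A) \<le> real m" using real_arch_simple by blast
  have "norm (A *v u) \<le> real (max D m) * norm u" for u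
  proof -
    have "norm (A *v u) \<le> onorm ((*v) A) * norm u" by (rule norm_le_onorm)
    also have "\<dots> \<le> real (max D m) * norm u" using m by (intro mult_right_mono) auto
    finally show ?thesis .
  qed
  with D show ?thesis unfolding tame_def by (intro exI[of _ "max D m"] conjI exI[of _ "real D"]) auto
qed

text \<open>Contracting axis \<open>a\<close> costs an expansion of axis \<open>b\<close> to keep
  the determinant 1; two distinct axes exist because d \<ge> 2.\<close>

definition stretch :: "'n \<Rightarrow> 'n \<Rightarrow> real \<Rightarrow> real^'n^'n" where
  "stretch a b N = (\<chi> i j. if i = j then if i = a then 1 / N else if i = b then N else 1 else 0)"

lemma stretch_vec:
  "(stretch a b N *v u) $ i = (if i = a then 1 / N else if i = b then N else 1) * u $ i"
proof -
  have "(stretch a b N *v u) $ i = (\<Sum>j\<in>UNIV. if j = i then (if i = a then 1 / N else if i = b then N else 1) * u $ i else 0)"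
    unfolding matrix_vector_mult_def stretch_def vec_lambda_beta by (intro sum.cong) auto
  then show ?thesis by simp
qed

lemma stretch_in_SL:
  assumes "a \<noteq> b" "N \<noteq> 0"
  shows "stretch a b N \<in> carrier SL"
proof -
  have "det (stretch a b N) = (\<Prod>i\<in>UNIV. if i = a then 1 / N else if i = b then N else 1)"
    by (subst det_diagonal) (auto simp: stretch_def intro!: prod.cong)
  also have "\<dots> = (\<Prod>i\<in>{a,b}. if i = a then 1 / N else if i = b then N else 1)"
    by (intro prod.mono_neutral_right) auto
  also have "\<dots> = 1" using assms by simp
  finally show ?thesis by (simp add: carrier_SL)
qed

lemma stretch_in_SLQ: "a \<noteq> b \<Longrightarrow> N > 0 \<Longrightarrow> stretch a b (real N) \<in> SLQ"
  unfolding SLQ_def using stretch_in_SL[of a b "real N"] by (auto simp: stretch_def)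

lemma stretch_tame:
  assumes "a \<noteq> b" "N > 0"
  shows "tame (real N) (stretch a b (real N))"
proof -
  have N: "real N \<ge> 1" using assms by simp
  then have N2: "real N * real N \<ge> 1" by (metis mult_mono' mult_1 zero_le_one)
  have "norm (stretch a b (real N) *v u) \<le> real N * norm u" for u
  proof -
    have "\<bar>(stretch a b (real N) *v u) $ i\<bar> \<le> \<bar>(real N *\<^sub>R u) $ i\<bar>" for i
    proof -
      have "\<bar>if i = a then 1 / real N else if i = b then real N else 1\<bar> \<le> real N"
        using N N2 by (auto simp: divide_simps)
      then show ?thesis unfolding stretch_vec vector_scaleR_component
        unfolding real_scaleR_def abs_mult by (intro mult_right_mono) auto
    qed
    then have "norm (stretch a b (real N) *v u) \<le> norm (real N *\<^sub>R u)"
      by (intro norm_le_componentwise_cart) simp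
    then show ?thesis by simp
  qed
  moreover have "clears_denom (real N) (stretch a b (real N))"
    unfolding clears_denom_def
  proof
    fix u :: "real^'a" assume u: "u \<in> int_vecs"
    \<comment> \<open>This is \<open>N\<close> times the inverse of the diagonal matrix, applied to
      \<open>u\<close>.\<close>
    let ?v = "\<chi> i. (if i = a then real N * real N else if i = b then 1 else real N) * u $ i"
    have "?v \<in> int_vecs" using u by (auto simp: int_vecs_def)
    moreover have "stretch a b (real N) *v ?v = real N *\<^sub>R u"
      using assms unfolding vec_eq_iff stretch_vec by auto
    ultimately show "\<exists>v\<in>int_vecs. stretch a b (real N) *v v = real N *\<^sub>R u" by blast
  qed
  ultimately show ?thesis unfolding tame_def using assms by (auto intro!: exI[of _ "real N"])
qed

lemma onorm_stretch:
  assumes "a \<noteq> b" "N > 0"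
  shows "onorm ((*v) (stretch a b (real N))) = real N"
proof (rule antisym)
  show "onorm ((*v) (stretch a b (real N))) \<le> real N"
    using stretch_tame[OF assms] by (intro onorm_le) (auto simp: tame_def)
  \<comment> \<open>The upper bound is attained on the expanded axis.\<close>
  have "stretch a b (real N) *v axis b 1 = real N *\<^sub>R axis b 1"
    using assms unfolding vec_eq_iff stretch_vec by (auto simp: axis_def)
  then have "norm (stretch a b (real N) *v axis b 1) = real N" by (simp add: norm_axis_1)
  then show "real N \<le> onorm ((*v) (stretch a b (real N)))"
    using norm_le_onorm[of "stretch a b (real N)" "axis b 1"] by (simp add: norm_axis_1)
qed

section \<open>Countability and density of the rational points\<close>

lemma countable_SLQ: "countable (SLQ :: (real^'n^'n) set)"
proof -
  have "SLQ \<subseteq> range (\<lambda>f :: 'n \<Rightarrow> 'n \<Rightarrow> rat. \<chi> i j. (of_rat (f i j) :: real))"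
  proof
    fix A :: "real^'n^'n" assume "A \<in> SLQ"
    then have "\<forall>i j. \<exists>q. A $ i $ j = of_rat q" unfolding SLQ_def by (metis (no_types, lifting) Rats_cases mem_Collect_eq)
    then obtain f where "\<And>i j. A $ i $ j = of_rat (f i j)" by metis
    then have "A = (\<chi> i j. of_rat (f i j))" by (simp add: vec_eq_iff)
    then show "A \<in> range (\<lambda>f :: 'n \<Rightarrow> 'n \<Rightarrow> rat. \<chi> i j. (of_rat (f i j) :: real))" by blast
  qed
  then show ?thesis by (rule countable_subset) simp
qed

lemma SLQ_mult: "A \<in> SLQ \<Longrightarrow> B \<in> SLQ \<Longrightarrow> A ** B \<in> SLQ"
  by (auto simp: SLQ_def carrier_SL det_mul) (auto simp: matrix_matrix_mult_def intro!: Rats_sum)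

lemma mat_1_SLQ: "mat 1 \<in> SLQ"
  by (auto simp: SLQ_def carrier_SL) (auto simp: mat_def)

text \<open>A nearby rational matrix has determinant close to 1; dividing one row by it repairs the determinant.\<close>

lemma SLQ_dense:
  fixes A :: "real^'n^'n"
  assumes "A \<in> carrier SL" "open T" "A \<in> T"
  shows "\<exists>B\<in>SLQ. B \<in> T"
proof -
  have "\<forall>n i j. \<exists>r. r \<in> \<rat> \<and> \<bar>r - A $ i $ j\<bar> < 1 / (real n + 1)"
  proof (intro allI)
    fix n :: nat and i j
    show "\<exists>r. r \<in> \<rat> \<and> \<bar>r - A $ i $ j\<bar> < 1 / (real n + 1)"
    using Rats_dense_in_real[of "A $ i $ j" "A $ i $ j + 1 / (real n + 1)"] by force
  qed
  then obtain q where q: "\<And>n i j. q n i j \<in> \<rat>" "\<And>n i j. \<bar>q n i j - A $ i $ j\<bar> < 1 / (real n + 1)"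
    by metis
  have lim: "(\<lambda>n. q n i j) \<longlonglongrightarrow> A $ i $ j" for i j
  proof (rule LIM_zero_cancel, rule Lim_null_comparison)
    show "\<forall>\<^sub>F n in sequentially. norm (q n i j - A $ i $ j) \<le> 1 / (real n + 1)"
      using q(2) by (intro always_eventually) (auto intro: less_imp_le)
    show "(\<lambda>n. 1 / (real n + 1)) \<longlonglongrightarrow> 0" using LIMSEQ_inverse_real_of_nat by (simp add: inverse_eq_divide add.commute)
  qed
  define B where "B n = (\<chi> i j. q n i j)" for n
  have detlim: "(\<lambda>n. det (B n)) \<longlonglongrightarrow> 1"
  proof -
    have "(\<lambda>n. det (B n)) \<longlonglongrightarrow> det A"
      unfolding det_def B_def by (auto intro!: tendsto_intros lim)
    then show ?thesis using assms(1) by (simp add: carrier_SL)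
  qed
  fix k :: 'n
  define C where "C n = (\<chi> i. if i = k then (1 / det (B n)) *s (B n $ i) else B n $ i)" for n
  have "(\<lambda>n. C n $ i $ j) \<longlonglongrightarrow> A $ i $ j" for i j
  proof (cases "i = k")
    case True
    have "(\<lambda>n. 1 / det (B n) * q n i j) \<longlonglongrightarrow> 1 / 1 * A $ i $ j"
      by (intro tendsto_intros lim detlim) simp
    then show ?thesis using True by (simp add: C_def B_def)
  next
    case False
    then show ?thesis using lim by (simp add: C_def B_def)
  qed
  then have "C \<longlonglongrightarrow> A" by (intro vec_tendstoI)
  then have "\<forall>\<^sub>F n in sequentially. C n \<in> T" using assms(2,3) by (rule topological_tendstoD)
  moreover have "\<forall>\<^sub>F n in sequentially. det (B n) \<noteq> 0"
    using detlim tendsto_imp_eventually_ne by fastforce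
  ultimately obtain n where n: "C n \<in> T" "det (B n) \<noteq> 0"
    by (metis (mono_tags, lifting) eventually_conj_iff eventually_sequentially order_refl)
  have "det (C n) = (1 / det (B n)) * det (\<chi> i. if i = k then B n $ i else B n $ i)"
    unfolding C_def by (rule det_row_mul)
  also have "\<dots> = 1" using n(2) by simp
  finally have "det (C n) = 1" .
  moreover have "C n $ i $ j \<in> \<rat>" for i j
  proof -
    have "det (B n) \<in> \<rat>" by (rule det_Rats) (simp add: B_def q)
    then show ?thesis by (auto simp: C_def B_def q)
  qed
  ultimately show ?thesis using n(1) by (auto simp: SLQ_def carrier_SL)
qed

section \<open>Random walks of atomic measures\<close>

lemma sets_mconv [simp]: "sets (mconv \<mu> \<nu>) = sets SL_borel"
  by (simp add: mconv_def)

lemma sets_mconv_pow [simp]: "sets (mconv_pow \<mu> n) = sets SL_borel"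
  by (cases n) auto

lemma measurable_mult_pair:
  fixes \<mu> \<nu> :: "(real^'n^'n) measure"
  assumes "sets \<mu> = sets SL_borel" "sets \<nu> = sets SL_borel"
  shows "(\<lambda>(g, h). g ** h) \<in> measurable (\<mu> \<Otimes>\<^sub>M \<nu>) SL_borel"
  using measurable_SL_mult
  by (subst measurable_cong_sets[OF sets_pair_measure_cong[OF assms] refl])

lemma prob_space_mconv_pow:
  assumes "prob_space \<mu>" "sets \<mu> = sets SL_borel"
  shows "prob_space (mconv_pow \<mu> n)"
proof (induction n)
  case 0
  show ?case by (simp add: carrier_SL prob_space_return)
next
  case (Suc n)
  interpret pair_prob_space \<mu> "mconv_pow \<mu> n"
    using Suc assms by (simp add: pair_prob_space_def pair_sigma_finite_def prob_space_imp_sigma_finite)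
  show ?case unfolding mconv_pow.simps mconv_def
    by (rule P.prob_space_distr) (use assms in \<open>auto intro: measurable_mult_pair\<close>)
qed

text \<open>Tonelli's theorem, with the preimage of \<open>T\<close> under multiplication cut into
  slices of fixed left factor.\<close>

lemma emeasure_mconv:
  fixes \<mu> \<nu> :: "(real^'n^'n) measure"
  assumes "sets \<mu> = sets SL_borel" "sets \<nu> = sets SL_borel" "prob_space \<nu>" "T \<in> sets SL_borel"
  shows "emeasure (mconv \<mu> \<nu>) T = (\<integral>\<^sup>+g. emeasure \<nu> {h \<in> carrier SL. g ** h \<in> T} \<partial>\<mu>)"
    and "(\<lambda>g. emeasure \<nu> {h \<in> carrier SL. g ** h \<in> T}) \<in> borel_measurable \<mu>"
    and "g \<in> carrier SL \<Longrightarrow> {h \<in> carrier SL. g ** h \<in> T} \<in> sets \<nu>"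
proof -
  interpret \<nu>: prob_space \<nu> by fact
  have sp: "space \<mu> = carrier SL" "space \<nu> = carrier SL"
    using sets_eq_imp_space_eq[OF assms(1)] sets_eq_imp_space_eq[OF assms(2)] by auto
  let ?X = "(\<lambda>(g, h). g ** h) -` T \<inter> space (\<mu> \<Otimes>\<^sub>M \<nu>)"
  have X: "?X \<in> sets (\<mu> \<Otimes>\<^sub>M \<nu>)"
    using measurable_mult_pair[OF assms(1,2)] assms(4) by (rule measurable_sets)
  have sec: "Pair g -` ?X = {h \<in> carrier SL. g ** h \<in> T}" if "g \<in> carrier SL" for g
    using that by (auto simp: space_pair_measure sp)
  have "emeasure (mconv \<mu> \<nu>) T = emeasure (\<mu> \<Otimes>\<^sub>M \<nu>) ?X"
    unfolding mconv_def by (rule emeasure_distr[OF measurable_mult_pair[OF assms(1,2)] assms(4)])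
  also have "\<dots> = (\<integral>\<^sup>+g. emeasure \<nu> (Pair g -` ?X) \<partial>\<mu>)"
    by (rule \<nu>.emeasure_pair_measure_alt[OF X])
  also have "\<dots> = (\<integral>\<^sup>+g. emeasure \<nu> {h \<in> carrier SL. g ** h \<in> T} \<partial>\<mu>)"
    by (intro nn_integral_cong) (simp only: sp sec)
  finally show "emeasure (mconv \<mu> \<nu>) T = (\<integral>\<^sup>+g. emeasure \<nu> {h \<in> carrier SL. g ** h \<in> T} \<partial>\<mu>)" .
  have "(\<lambda>g. emeasure \<nu> (Pair g -` ?X)) \<in> borel_measurable \<mu>"
    by (rule \<nu>.measurable_emeasure_Pair[OF X])
  then show "(\<lambda>g. emeasure \<nu> {h \<in> carrier SL. g ** h \<in> T}) \<in> borel_measurable \<mu>"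
    by (rule measurable_cong[THEN iffD1, rotated]) (simp only: sp sec)
  show "{h \<in> carrier SL. g ** h \<in> T} \<in> sets \<nu>" if "g \<in> carrier SL"
    using sets_Pair1[OF X, of g] sec[OF that] by simp
qed

section \<open>Measures carried by a sequence of atoms\<close>

definition atomic_measure :: "nat pmf \<Rightarrow> (nat \<Rightarrow> real^'n^'n) \<Rightarrow> (real^'n^'n) measure" where
  "atomic_measure P s = distr (measure_pmf P) SL_borel s"

lemma sets_atomic_measure [simp]: "sets (atomic_measure P s) = sets SL_borel"
  by (simp add: atomic_measure_def)

lemma measurable_seq_SL: "range s \<subseteq> carrier SL \<Longrightarrow> s \<in> measurable (measure_pmf P) SL_borel"
  by (auto simp: measurable_def)

lemma prob_space_atomic_measure: fixes P :: "nat pmf" shows "range s \<subseteq> carrier SL \<Longrightarrow> prob_space (atomic_measure P s)"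
  unfolding atomic_measure_def
  by (intro measure_pmf.prob_space_distr measurable_seq_SL)

text \<open>One step of the walk, conditioned on the newest, leftmost factor. The events
  \<open>k \<in> K\<close> and \<open>k = j\<close> are disjoint, so their contributions add. In the
  application \<open>K\<close> holds the smaller atoms and \<open>j\<close> is the jump.\<close>

lemma mconv_atomic_ge:
  fixes A B T :: "(real^'n^'n) set" and P :: "nat pmf"
  assumes s: "range s \<subseteq> carrier SL"
    and \<nu>: "sets \<nu> = sets SL_borel" "prob_space \<nu>"
    and T: "T \<in> sets SL_borel" and AB: "A \<subseteq> carrier SL" "B \<subseteq> carrier SL"
    and A: "\<And>k h. k \<in> K \<Longrightarrow> h \<in> A \<Longrightarrow> s k ** h \<in> T"
    and B: "\<And>h. h \<in> B \<Longrightarrow> s j ** h \<in> T" and "j \<notin> K"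
    and ab: "a \<le> emeasure \<nu> A" "b \<le> emeasure \<nu> B"
  shows "a * emeasure P K + b * emeasure P {j} \<le> emeasure (mconv (atomic_measure P s) \<nu>) T"
proof -
  note E = emeasure_mconv[OF sets_atomic_measure[of P s] \<nu> T]
  let ?F = "\<lambda>g. emeasure \<nu> {h \<in> carrier SL. g ** h \<in> T}"
  have "a * emeasure P K + b * emeasure P {j} = (\<integral>\<^sup>+k. a * indicator K k + b * indicator {j} k \<partial>P)"
    by (simp add: nn_integral_add nn_integral_cmult)
  also have "\<dots> \<le> (\<integral>\<^sup>+k. ?F (s k) \<partial>P)"
  proof (intro nn_integral_mono)
    fix k
    have sk: "s k \<in> carrier SL" using s by auto
    show "a * indicator K k + b * indicator {j} k \<le> ?F (s k)"
    proof (cases "k \<in> K")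
      case True
      then have "emeasure \<nu> A \<le> ?F (s k)"
        using A AB by (intro emeasure_mono E(3)[OF sk]) auto
      with True \<open>j \<notin> K\<close> ab show ?thesis by (auto simp: indicator_def intro: order_trans)
    next
      case False
      have "emeasure \<nu> B \<le> ?F (s k)" if "k = j"
        using B AB that by (intro emeasure_mono E(3)[OF sk]) auto
      with False ab show ?thesis by (auto simp: indicator_def intro: order_trans)
    qed
  qed
  also have "\<dots> = (\<integral>\<^sup>+g. ?F g \<partial>atomic_measure P s)"
    unfolding atomic_measure_def using E(2)
    by (intro nn_integral_distr[symmetric] measurable_seq_SL s) (simp add: atomic_measure_def)
  also have "\<dots> = emeasure (mconv (atomic_measure P s) \<nu>) T" by (rule E(1)[symmetric])
  finally show ?thesis .
qed

text \<open>Simple functions below the integrand suffice, so it need not be measurable.\<close>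

lemma nn_integral_distr_le:
  assumes "T \<in> measurable M N"
  shows "(\<integral>\<^sup>+x. f x \<partial>distr M N T) \<le> (\<integral>\<^sup>+x. f (T x) \<partial>M)"
  unfolding nn_integral_def[of "distr M N T"]
proof (intro SUP_least)
  fix g assume g: "g \<in> {g. simple_function (distr M N T) g \<and> g \<le> f}"
  then have "integral\<^sup>S (distr M N T) g = (\<integral>\<^sup>+x. g x \<partial>distr M N T)"
    by (simp add: nn_integral_eq_simple_integral)
  also have "\<dots> = (\<integral>\<^sup>+x. g (T x) \<partial>M)"
    using g assms by (intro nn_integral_distr) (auto dest: borel_measurable_simple_function)
  also have "\<dots> \<le> (\<integral>\<^sup>+x. f (T x) \<partial>M)"
    using g by (intro nn_integral_mono) (auto simp: le_fun_def)
  finally show "integral\<^sup>S (distr M N T) g \<le> (\<integral>\<^sup>+x. f (T x) \<partial>M)" .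
qed

lemma countable_SL_borel:
  fixes A :: "(real^'n^'n) set"
  assumes "countable A" "A \<subseteq> carrier SL"
  shows "A \<in> sets SL_borel"
proof -
  have "A \<in> sets borel" using assms(1) by (rule sets.countable[rotated]) simp
  moreover have "A = carrier SL \<inter> A" using assms(2) by auto
  ultimately show ?thesis unfolding SL_borel_def sets_restrict_space by (metis imageI)
qed

lemma emeasure_atomic_measure_pos:
  assumes "range s \<subseteq> carrier SL" "U \<in> sets SL_borel" "s k \<in> U" "pmf P k > 0"
  shows "emeasure (atomic_measure P s) U > 0"
proof -
  have "0 < ennreal (pmf P k)" using assms(4) by simp
  also have "\<dots> = emeasure P {k}" by (simp add: emeasure_pmf_single)
  also have "\<dots> \<le> emeasure P (s -` U \<inter> space P)" using assms(3) by (intro emeasure_mono) auto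
  also have "\<dots> = emeasure (atomic_measure P s) U"
    unfolding atomic_measure_def by (rule emeasure_distr[OF measurable_seq_SL[OF assms(1)] assms(2), symmetric])
  finally show ?thesis .
qed

text \<open>Every nonempty relatively open set contains an atom of positive mass, so the support is
  already the whole group.\<close>

lemma zariski_dense_atomic_measure:
  fixes s :: "nat \<Rightarrow> real^'n^'n"
  assumes s: "range s \<subseteq> carrier SL" and "\<And>k. pmf P k > 0"
    and dense: "\<And>A T. A \<in> carrier SL \<Longrightarrow> open T \<Longrightarrow> A \<in> T \<Longrightarrow> \<exists>k. s k \<in> T"
  shows "zariski_dense_measure (atomic_measure P s)"
proof -
  have pos: "emeasure (atomic_measure P s) U > 0"
    if U: "openin (top_of_set (carrier SL)) U" "A \<in> U" for A and U :: "(real^'n^'n) set"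
  proof -
    obtain T where T: "open T" "U = carrier SL \<inter> T" using U(1) unfolding openin_open by blast
    obtain k where k: "s k \<in> T" using dense[of A T] T U(2) by auto
    have "U \<in> sets SL_borel"
      unfolding SL_borel_def sets_restrict_space T(2) using T(1) by (intro imageI) simp
    moreover have "s k \<in> U" using k s unfolding T(2) by auto
    ultimately show ?thesis
      using assms(2) by (intro emeasure_atomic_measure_pos[OF s])
  qed
  have "carrier SL \<subseteq> semigroup_generated (msupport (atomic_measure P s))"
  proof
    fix A :: "real^'n^'n" assume "A \<in> carrier SL"
    then have "A \<in> msupport (atomic_measure P s)" unfolding msupport_def using pos by blast
    then show "A \<in> semigroup_generated (msupport (atomic_measure P s))"
      by (rule semigroup_generated.gen)
  qed
  moreover have "Z \<subseteq> carrier SL" if "zariski_closed_SL Z" for Z :: "(real^'n^'n) set"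
    using that unfolding zariski_closed_SL_def by blast
  ultimately show ?thesis
    unfolding zariski_dense_measure_def zariski_dense_SL_def by (meson order_trans subset_antisym)
qed

section \<open>Short lattice vectors\<close>

text \<open>With determinant 1, Cramer's rule gives the coordinates of the solution as determinants
  of integer matrices.\<close>

lemma SLZ_surj_int_vecs:
  fixes \<gamma> :: "real^'n^'n"
  assumes "\<gamma> \<in> SLZ" "v \<in> int_vecs"
  shows "\<exists>w\<in>int_vecs. \<gamma> *v w = v"
proof -
  have d: "det \<gamma> = 1" using assms by (simp add: SLZ_def carrier_SL)
  define w where "w = (\<chi> k. det (\<chi> i j. if j = k then v $ i else \<gamma> $ i $ j))"
  have "\<gamma> *v w = v" using cramer[of \<gamma> w v] d by (simp add: w_def)
  moreover have "w \<in> int_vecs"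
    using assms by (auto simp: int_vecs_def SLZ_def w_def intro!: det_Ints)
  ultimately show ?thesis by blast
qed

lemma SL_mult_nonzero:
  fixes A :: "real^'n^'n"
  assumes "A \<in> carrier SL" "v \<noteq> 0"
  shows "A *v v \<noteq> 0"
proof -
  have "invertible A" using assms by (simp add: carrier_SL invertible_det_nz)
  then obtain B where "B ** A = mat 1" by (auto simp: invertible_def)
  then have "B *v (A *v v) = v" by (simp add: matrix_vector_mul_assoc)
  then show ?thesis using assms(2) by (metis matrix_vector_mult_0_right)
qed

lemma int_vecs_norm_ge_1:
  assumes "v \<in> int_vecs" "v \<noteq> 0"
  shows "norm v \<ge> 1"
proof -
  obtain i where i: "v $ i \<noteq> 0" using assms(2) by (auto simp: vec_eq_iff)
  then have "1 \<le> \<bar>v $ i\<bar>" using assms(1) by (auto simp: int_vecs_def intro: Ints_nonzero_abs_ge1)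
  also have "\<dots> \<le> norm v" by (rule component_le_norm_cart)
  finally show ?thesis .
qed

text \<open>The norm of \<open>A *v u\<close> attains its minimum over the compact set of pairs with
  \<open>A\<close> bounded of determinant 1 and \<open>u\<close> a unit vector. The minimum is
  positive because each \<open>A\<close> is injective, and homogeneity extends the bound to all
  \<open>u\<close>.\<close>

lemma bounded_SL_norm_lower_bound:
  "\<exists>c>0. \<forall>A\<in>carrier SL. \<forall>u :: real^'n. norm A \<le> R \<longrightarrow> c * norm u \<le> norm (A *v u)"
proof -
  let ?K = "carrier SL \<inter> cball 0 R :: (real^'n^'n) set"
  let ?S = "sphere 0 1 :: (real^'n) set"
  have "continuous_on UNIV (det :: real^'n^'n \<Rightarrow> real)"
    unfolding det_def by (intro continuous_intros)
  then have "closed {A :: real^'n^'n. det A = 1}"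
    by (intro closed_Collect_eq continuous_intros)
  then have K: "compact (?K \<times> ?S)"
    unfolding carrier_SL by (intro compact_Times closed_Int_compact) auto
  show ?thesis
  proof (cases "?K \<times> ?S = {}")
    \<comment> \<open>No matrix in the group meets the norm bound, for instance when
      \<open>R\<close> is negative; any positive constant will do.\<close>
    case True
    have "?S \<noteq> {}" by simp
    with True have "?K = {}" by blast
    then show ?thesis by (intro exI[of _ 1]) auto
  next
    case False
    have "continuous_on (?K \<times> ?S) (\<lambda>p. norm (fst p *v snd p))"
      unfolding matrix_vector_mult_def by (intro continuous_intros)
    from continuous_attains_inf[OF K False this] obtain A u where
      Au: "A \<in> ?K" "u \<in> ?S" and min: "\<And>B v. B \<in> ?K \<Longrightarrow> v \<in> ?S \<Longrightarrow> norm (A *v u) \<le> norm (B *v v)"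
      by fastforce
    have "u \<noteq> 0" using Au by auto
    then have "A *v u \<noteq> 0" using Au by (intro SL_mult_nonzero) auto
    moreover have "norm (A *v u) * norm v \<le> norm (B *v v)"
      if "B \<in> carrier SL" "norm B \<le> R" for B :: "real^'n^'n" and v
    proof (cases "v = 0")
      case False
      have "norm (A *v u) \<le> norm (B *v ((1 / norm v) *\<^sub>R v))"
        using that False by (intro min) auto
      also have "\<dots> = norm (B *v v) / norm v"
        using False by (simp add: matrix_vector_mult_scaleR)
      finally show ?thesis using False by (simp add: field_simps)
    qed auto
    ultimately show ?thesis by (intro exI[of _ "norm (A *v u)"]) auto
  qed
qed

text \<open>Mahler's criterion, easy direction: the lattices in a compact set have no short vectors, since the
  cosets that have a representative of norm less than \<open>m\<close> form an open cover as \<open>m\<close> grows.\<close>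

lemma compactin_homspace_shortest:
  fixes M :: "(real^'n^'n) set set"
  assumes "compactin homspace_top M"
  shows "\<exists>\<delta>>0. \<forall>A\<in>carrier SL. \<forall>v\<in>int_vecs.
           A <#\<^bsub>SL\<^esub> SLZ \<in> M \<and> v \<noteq> 0 \<longrightarrow> \<delta> \<le> norm (A *v v)"
proof -
  define W :: "nat \<Rightarrow> (real^'n^'n) set set"
    where "W m = {x \<in> homspace. \<exists>g\<in>x. norm g < real m}" for m
  have coset: "A <#\<^bsub>SL\<^esub> SLZ = {A ** \<gamma> |\<gamma>. \<gamma> \<in> SLZ}" for A :: "real^'n^'n"
    by (auto simp: l_coset_def)
  have hom: "{A ** \<gamma> |\<gamma>. \<gamma> \<in> SLZ} \<in> homspace" if "A \<in> carrier SL" for A :: "real^'n^'n"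
    using coset_in_homspace[OF that] unfolding coset .
  have "openin homspace_top (W m)" for m
  proof -
    \<comment> \<open>The representatives of the coset of \<open>g\<close> are the products
      \<open>g ** \<gamma>\<close>, so the preimage of \<open>W m\<close> is a union of open
      conditions on \<open>g\<close>.\<close>
    have "{g \<in> carrier SL. g <#\<^bsub>SL\<^esub> SLZ \<in> W m}
            = carrier SL \<inter> (\<Union>\<gamma>\<in>SLZ. (\<lambda>g. g ** \<gamma>) -` ball 0 (real m))"
      using hom by (auto simp: W_def coset)
    moreover have "open ((\<lambda>g :: real^'n^'n. g ** \<gamma>) -` ball 0 (real m))" for \<gamma> :: "real^'n^'n"
      unfolding matrix_matrix_mult_def by (intro open_vimage continuous_intros) auto
    ultimately show ?thesis
      unfolding openin_homspace_top by (auto simp: W_def intro!: openin_open_Int)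
  qed
  moreover have "M \<subseteq> \<Union>(range W)"
  proof
    fix x assume "x \<in> M"
    then have x: "x \<in> homspace" using compactin_subset_topspace[OF assms] by auto
    then obtain A where "x = A <#\<^bsub>SL\<^esub> SLZ" by (auto simp: homspace_def LCOSETS_def)
    moreover have "mat 1 \<in> (SLZ :: (real^'n^'n) set)" by (simp add: SLZ_def carrier_SL) (simp add: mat_def)
    ultimately have "A ** mat 1 \<in> x" unfolding coset by blast
    moreover obtain m :: nat where "norm (A ** mat 1) < real m" using reals_Archimedean2 by blast
    ultimately show "x \<in> \<Union>(range W)" using x unfolding W_def by blast
  qed
  ultimately obtain F where F: "finite F" "F \<subseteq> range W" "M \<subseteq> \<Union>F"
    using compactinD[OF assms, of "range W"] by blast
  from finite_subset_image[OF F(1,2)] obtain I where I: "finite I" "F = W ` I" by auto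
  \<comment> \<open>The inserted 0 keeps \<open>Max\<close> meaningful if the subcover is
    empty.\<close>
  define m where "m = Max (insert 0 I)"
  have m: "i \<le> m" if "i \<in> I" for i using I that by (auto simp: m_def)
  have M: "\<exists>g\<in>x. norm g \<le> real m" if x: "x \<in> M" for x
  proof -
    obtain i g where "i \<in> I" "g \<in> x" "norm g < real i"
      using x F(3) unfolding I(2) W_def by blast
    then show ?thesis using m[of i] by (intro bexI[of _ g]) auto
  qed
  obtain c where c: "c > 0" "\<And>A u. A \<in> carrier SL \<Longrightarrow> norm A \<le> real m \<Longrightarrow> c * norm u \<le> norm (A *v (u :: real^'n))"
    using bounded_SL_norm_lower_bound[of "real m"] by blast
  show ?thesis
  proof (intro exI[of _ c] conjI ballI impI c(1))
    fix A :: "real^'n^'n" and v :: "real^'n"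
    assume A: "A \<in> carrier SL" and v: "v \<in> int_vecs" and Mv: "A <#\<^bsub>SL\<^esub> SLZ \<in> M \<and> v \<noteq> 0"
    then obtain \<gamma> where \<gamma>: "\<gamma> \<in> SLZ" "norm (A ** \<gamma>) \<le> real m"
      using M[of "A <#\<^bsub>SL\<^esub> SLZ"] unfolding coset by blast
    obtain w where w: "w \<in> int_vecs" "\<gamma> *v w = v" using SLZ_surj_int_vecs[OF \<gamma>(1) v] by blast
    have "w \<noteq> 0" using w(2) Mv by auto
    \<comment> \<open>The vector \<open>A *v v\<close> equals \<open>(A ** \<gamma>) *v w\<close>:
      the representative is now bounded, and the nonzero integer vector \<open>w\<close> has length
      at least 1.\<close>
    then have "c * 1 \<le> c * norm w" using c(1) int_vecs_norm_ge_1[OF w(1)] by (intro mult_left_mono) auto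
    also have "\<dots> \<le> norm ((A ** \<gamma>) *v w)"
      using A \<gamma> by (intro c(2)) (auto simp: SLZ_def carrier_SL det_mul)
    also have "(A ** \<gamma>) *v w = A *v v" by (simp add: matrix_vector_mul_assoc[symmetric] w(2))
    finally show "c \<le> norm (A *v v)" by simp
  qed
qed

section \<open>Denominators and short vectors along the walk\<close>

definition bounded_denom :: "real \<Rightarrow> (real^'n^'n) set" where
  "bounded_denom C = {A \<in> SLQ. \<exists>D. 0 < D \<and> D \<le> C \<and> clears_denom D A}"

text \<open>The state of the walk after the jump, as \<open>bounded_denom\<close> is its state
  before. Both sets lie in the countable set \<open>SLQ\<close>, which makes them measurable at
  once.\<close>

definition short :: "real \<Rightarrow> (real^'n^'n) set" where
  "short r = {A \<in> SLQ. \<exists>v\<in>int_vecs. v \<noteq> 0 \<and> norm (A *v v) \<le> r}"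

lemma bounded_denom_mult:
  assumes "A \<in> SLQ" "tame C A" "B \<in> bounded_denom E"
  shows "A ** B \<in> bounded_denom (C * E)"
proof -
  obtain D D' where "0 < D" "D \<le> C" "clears_denom D A" "0 < D'" "D' \<le> E" "clears_denom D' B"
    using assms by (auto simp: tame_def bounded_denom_def)
  then show ?thesis using assms unfolding bounded_denom_def
    by (auto intro!: SLQ_mult exI[of _ "D * D'"] clears_denom_mult mult_mono)
qed

lemma short_mult:
  assumes "A \<in> SLQ" "tame C A" "0 \<le> C" "B \<in> short r"
  shows "A ** B \<in> short (C * r)"
proof -
  obtain v where v: "v \<in> int_vecs" "v \<noteq> 0" "norm (B *v v) \<le> r" using assms by (auto simp: short_def)
  have "norm (A *v (B *v v)) \<le> C * norm (B *v v)" using assms(2) by (simp add: tame_def)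
  also have "\<dots> \<le> C * r" using v assms(3) by (intro mult_left_mono)
  finally show ?thesis using assms v unfolding short_def
    by (auto intro!: SLQ_mult bexI[of _ v] simp: matrix_vector_mul_assoc)
qed

lemma short_mono: "r \<le> r' \<Longrightarrow> short r \<subseteq> short r'"
  by (fastforce simp: short_def)

text \<open>The lattice of \<open>A\<close> contains D e_a for some \<open>D \<le> E\<close>, and
  the contraction turns this vector into (D/N) e_a.\<close>

lemma stretch_bounded_denom:
  fixes a b :: "'n::finite"
  assumes "a \<noteq> b" "N > 0" "A \<in> bounded_denom E"
  shows "stretch a b (real N) ** A \<in> short (E / real N)"
proof -
  obtain D where D: "0 < D" "D \<le> E" "clears_denom D A" using assms by (auto simp: bounded_denom_def)
  have "axis a 1 \<in> (int_vecs :: (real^'n) set)" by (auto simp: int_vecs_def axis_def)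
  then obtain v where v: "v \<in> int_vecs" "A *v v = D *\<^sub>R axis a 1"
    using D by (auto simp: clears_denom_def)
  have "v \<noteq> 0" using v D by (auto simp: axis_eq_0_iff)
  moreover have "stretch a b (real N) *v axis a 1 = (1 / real N) *\<^sub>R axis a 1"
    unfolding vec_eq_iff stretch_vec by (auto simp: axis_def)
  then have "norm ((stretch a b (real N) ** A) *v v) = D / real N"
    using D by (simp add: matrix_vector_mul_assoc[symmetric] v(2) matrix_vector_mult_scaleR norm_axis_1)
  moreover have "D / real N \<le> E / real N" using D by (intro divide_right_mono) auto
  moreover have "A \<in> SLQ" using assms by (simp add: bounded_denom_def)
  ultimately show ?thesis using v(1) stretch_in_SLQ[of a b N] assms SLQ_mult unfolding short_def by auto
qed

lemma SLQ_subset: "SLQ \<subseteq> carrier SL"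
  by (auto simp: SLQ_def)

lemma sets_bounded_denom: "bounded_denom C \<in> sets SL_borel" and sets_short: "short r \<in> sets SL_borel"
  using SLQ_subset countable_SLQ
  by (auto simp: bounded_denom_def short_def intro!: countable_SL_borel intro: countable_subset)

text \<open>Joint induction on \<open>n\<close>, adding factors on the left. The first bound counts
  paths that use only atoms below \<open>k\<close>, the second those that use \<open>k\<close>
  exactly once, whence its binomial form. In the latter the new factor is either a smaller atom
  after an earlier jump, or the jump itself after a jump-free path.\<close>

lemma emeasure_walk_short:
  fixes P :: "nat pmf" and s :: "nat \<Rightarrow> real^('n::finite)^'n" and a b :: "'n::finite"
  assumes s: "range s \<subseteq> SLQ" and C: "C \<ge> 1"
    and tame: "\<And>i. i < k \<Longrightarrow> tame C (s i)"
    and sk: "s k = stretch a b (real N)" "a \<noteq> b" "N > 0"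
  defines "q \<equiv> measure P {..<k}" and "\<mu> \<equiv> atomic_measure P s"
  shows "ennreal (q ^ n) \<le> emeasure (mconv_pow \<mu> n) (bounded_denom (C ^ n))"
    and "ennreal (real n * pmf P k * q ^ (n - 1)) \<le> emeasure (mconv_pow \<mu> n) (short (C ^ n / real N))"
proof (induction n)
  case 0
  {
    case 1
    have "(mat 1 :: real^'n^'n) \<in> bounded_denom 1"
      using clears_denom_mat_1 by (auto simp: bounded_denom_def mat_1_SLQ intro!: exI[of _ 1])
    then show ?case by (simp add: sets_bounded_denom)
  next
    case 2
    show ?case by simp
  }
next
  case (Suc n)
  have sSL: "range s \<subseteq> carrier SL" using s SLQ_subset by blast
  have pr: "prob_space (mconv_pow \<mu> n)"
    unfolding \<mu>_def by (intro prob_space_mconv_pow prob_space_atomic_measure sSL) simp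
  note ge = mconv_atomic_ge[OF sSL sets_mconv_pow pr, where K = "{..<k}" and j = k]
  have emK: "emeasure P {..<k} = ennreal q" by (simp add: q_def measure_pmf.emeasure_eq_measure)
  have emk: "emeasure P {k} = ennreal (pmf P k)" by (simp add: emeasure_pmf_single)
  have sub: "bounded_denom E \<subseteq> carrier SL" "short E \<subseteq> carrier SL" for E
    using SLQ_subset by (auto simp: bounded_denom_def short_def)
  have q0: "q \<ge> 0" by (simp add: q_def)
  {
    case 1
    \<comment> \<open>Taking \<open>B = {}\<close> with weight 0 discards the paths whose new factor
      is the jump.\<close>
    have "ennreal (q ^ n) * emeasure P {..<k} + 0 * emeasure P {k}
            \<le> emeasure (mconv \<mu> (mconv_pow \<mu> n)) (bounded_denom (C ^ Suc n))"
      unfolding \<mu>_def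
      by (rule ge[where A = "bounded_denom (C ^ n)" and B = "{}", unfolded \<mu>_def])
         (use s sub Suc(1) in \<open>auto simp: sets_bounded_denom \<mu>_def intro!: bounded_denom_mult tame\<close>)
    then show ?case using q0 by (simp add: emK ennreal_mult'[symmetric] mult.commute)
  next
    case 2
    have K: "s j ** h \<in> short (C ^ Suc n / real N)" if "j < k" "h \<in> short (C ^ n / real N)" for j h
      using short_mult[of "s j" C h "C ^ n / real N"] that s C tame by force
    \<comment> \<open>The jump brings no factor \<open>C\<close> of its own; its radius is relaxed
      to the one common to both cases.\<close>
    have "C ^ n / real N \<le> C ^ Suc n / real N"
      using C by (intro divide_right_mono power_increasing) auto
    then have k: "s k ** h \<in> short (C ^ Suc n / real N)" if "h \<in> bounded_denom (C ^ n)" for h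
      using stretch_bounded_denom[OF sk(2,3) that] short_mono unfolding sk(1) by blast
    have "ennreal (real n * pmf P k * q ^ (n - 1)) * emeasure P {..<k} + ennreal (q ^ n) * emeasure P {k}
            \<le> emeasure (mconv \<mu> (mconv_pow \<mu> n)) (short (C ^ Suc n / real N))"
      unfolding \<mu>_def
      by (rule ge[where A = "short (C ^ n / real N)" and B = "bounded_denom (C ^ n)", unfolded \<mu>_def])
         (use sub Suc K k in \<open>auto simp: sets_short \<mu>_def\<close>)
    also have "ennreal (real n * pmf P k * q ^ (n - 1)) * emeasure P {..<k} + ennreal (q ^ n) * emeasure P {k}
        = ennreal (real n * pmf P k * q ^ (n - 1) * q + q ^ n * pmf P k)"
      using q0 by (simp add: emK emk ennreal_mult'[symmetric] ennreal_plus[symmetric] del: ennreal_plus)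
    \<comment> \<open>The case \<open>n = 0\<close> is separate because \<open>n - 1\<close>
      truncates; there the first summand vanishes.\<close>
    also have "real n * pmf P k * q ^ (n - 1) * q + q ^ n * pmf P k = real (Suc n) * pmf P k * q ^ (Suc n - 1)"
      by (cases n) (simp_all add: algebra_simps)
    finally show ?case by simp
  }
qed

section \<open>Choice of the masses\<close>

text \<open>\<open>T k\<close> is the mass of all indices from \<open>k\<close> on. Its successive
  differences are nonnegative and telescope to total mass 1.\<close>

lemma ex_pmf_of_tail:
  fixes T :: "nat \<Rightarrow> real"
  assumes T: "T 0 = 1" "decseq T" "T \<longlonglongrightarrow> 0"
  shows "\<exists>P. (\<forall>k. pmf P k = T k - T (Suc k)) \<and> (\<forall>k. measure P {..<k} = 1 - T k)"
proof -
  let ?f = "\<lambda>k. T k - T (Suc k)"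
  have nn: "0 \<le> ?f k" for k using T(2) by (simp add: decseq_SucD)
  have "?f sums (T 0 - 0)" by (rule telescope_sums'[OF T(3)])
  then have "(\<Sum>k. ennreal (?f k)) = ennreal 1"
    using nn T(1) by (intro suminf_ennreal_eq) auto
  then have "(\<integral>\<^sup>+k. ennreal (?f k) \<partial>count_space UNIV) = 1"
    by (simp add: nn_integral_count_space_nat)
  then have pmf: "pmf (embed_pmf ?f) k = ?f k" for k using nn by (intro pmf_embed_pmf)
  have "measure (embed_pmf ?f) {..<k} = 1 - T k" for k
  proof -
    have "measure (embed_pmf ?f) {..<k} = (\<Sum>i<k. ?f i)"
      by (simp add: measure_measure_pmf_finite pmf)
    also have "\<dots> = T 0 - T k" by (rule sum_lessThan_telescope')
    finally show ?thesis using T(1) by simp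
  qed
  with pmf show ?thesis by blast
qed

text \<open>This is where p < 1 enters: the exponent is positive, so \<open>n\<close> can outgrow a
  threshold \<open>L\<close> that depends on a constant fixed earlier.\<close>

lemma ex_large_powr:
  fixes p :: real
  assumes "p < 1"
  shows "\<exists>n::nat. real n \<ge> K \<and> (2 * real n) powr (1 - p) \<ge> L"
proof -
  have "filterlim (\<lambda>n. (2 * real n) powr (1 - p)) at_top sequentially"
    using assms by real_asymp
  then have "\<forall>\<^sub>F n in sequentially. (2 * real n) powr (1 - p) \<ge> L" by (simp add: filterlim_at_top)
  moreover have "\<forall>\<^sub>F n in sequentially. real n \<ge> K" by real_asymp
  ultimately have "\<forall>\<^sub>F n in sequentially. real n \<ge> K \<and> (2 * real n) powr (1 - p) \<ge> L"
    by eventually_elim auto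
  then show ?thesis by (auto simp: eventually_sequentially)
qed

text \<open>Moment contribution of a jump of norm C^(n+1) and mass at most 1/(2n). Since n + 1 \<le>
  2n, it is at most (ln C)^p / (2n)^(1-p).\<close>

lemma log_moment_step:
  fixes p C :: real
  assumes "0 < p" "C \<ge> 1" "n \<ge> 1" "2 ^ k * ln C powr p \<le> (2 * real n) powr (1 - p)"
  shows "1 / (2 * real n) * ln (C ^ (n + 1)) powr p \<le> (1 / 2) ^ k"
proof -
  have "ln (C ^ (n + 1)) = real (n + 1) * ln C" by (rule ln_realpow)
  also have "\<dots> \<le> (2 * real n) * ln C" using assms by (intro mult_right_mono) auto
  finally have "ln (C ^ (n + 1)) powr p \<le> ((2 * real n) * ln C) powr p"
    using assms one_le_power[of C "n + 1"] by (intro powr_mono2) auto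
  also have "\<dots> = (2 * real n) powr p * ln C powr p" using assms by (simp add: powr_mult)
  finally have "2 ^ k * ln (C ^ (n + 1)) powr p \<le> (2 * real n) powr p * (2 ^ k * ln C powr p)"
    by (simp add: mult.left_commute)
  also have "\<dots> \<le> (2 * real n) powr p * (2 * real n) powr (1 - p)"
    by (intro mult_left_mono assms) auto
  also have "\<dots> = 2 * real n" using assms by (simp add: powr_add[symmetric])
  finally show ?thesis using assms by (simp add: field_simps)
qed

text \<open>Here \<open>t\<close> and \<open>t'\<close> are consecutive tails, so
  \<open>t - t'\<close> is the mass of the jump. As n t = 1/2, the expected number of jumps is at
  least 1/4, and Bernoulli's inequality keeps the other factor above 1/2.\<close>

lemma single_jump_probability:
  fixes t t' :: real
  assumes "n \<ge> 1" "t = 1 / (2 * real n)" "t' \<le> t / 2"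
  shows "1 / 8 \<le> real n * (t - t') * (1 - t) ^ (n - 1)"
proof -
  have "real n * (t / 2) \<le> real n * (t - t')" using assms by (intro mult_left_mono) auto
  moreover have "real n * (t / 2) = 1 / 4" using assms by simp
  ultimately have jump: "1 / 4 \<le> real n * (t - t')" by linarith
  have "t \<le> 1" using assms(1,2) by simp
  then have "1 + real (n - 1) * (- t) \<le> (1 + (- t)) ^ (n - 1)"
    by (intro Bernoulli_inequality) simp
  moreover have "real (n - 1) * t \<le> real n * t" using assms by (intro mult_right_mono) auto
  moreover have "real n * t = 1 / 2" using assms by simp
  ultimately have "1 / 2 \<le> (1 - t) ^ (n - 1)" by simp
  with jump have "1 / 4 * (1 / 2) \<le> real n * (t - t') * (1 - t) ^ (n - 1)"
    by (intro mult_mono) auto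
  then show ?thesis by simp
qed

section \<open>Finite moment, escape of mass and the final construction\<close>

lemma finite_Lp_moment_atomic:
  assumes s: "range s \<subseteq> carrier SL"
    and bd: "\<And>k. pmf P k * (ln (onorm ((*v) (s k))) powr p) \<le> K * (1 / 2) ^ k" and "K \<ge> 0"
  shows "finite_Lp_moment p (atomic_measure P s)"
proof -
  let ?f = "\<lambda>g. ln (onorm ((*v) g)) powr p"
  have "(\<integral>\<^sup>+g. ennreal (?f g) \<partial>atomic_measure P s) \<le> (\<integral>\<^sup>+k. ennreal (?f (s k)) \<partial>P)"
    unfolding atomic_measure_def by (intro nn_integral_distr_le measurable_seq_SL s)
  also have "\<dots> = (\<integral>\<^sup>+k. ennreal (pmf P k * ?f (s k)) \<partial>count_space UNIV)"
    by (simp add: nn_integral_measure_pmf ennreal_mult)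
  also have "\<dots> \<le> (\<integral>\<^sup>+k. ennreal (K * (1 / 2) ^ k) \<partial>count_space UNIV)"
    by (intro nn_integral_mono ennreal_leI bd)
  also have "\<dots> = (\<Sum>k. ennreal (K * (1 / 2) ^ k))" by (rule nn_integral_count_space_nat)
  also have "\<dots> < \<infinity>"
  proof -
    have "summable (\<lambda>k. K * (1 / 2) ^ k)" by (intro summable_mult summable_geometric) simp
    then have "(\<Sum>k. ennreal (K * (1 / 2) ^ k)) \<noteq> \<infinity>"
      unfolding infinity_ennreal_def using \<open>K \<ge> 0\<close> by (intro ennreal_suminf_neq_top) simp_all
    then show ?thesis by (simp only: less_top infinity_ennreal_def not_False_eq_True)
  qed
  finally show ?thesis unfolding finite_Lp_moment_def .
qed

text \<open>A compact set excludes lattices with vectors shorter than some \<delta>, so it misses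
  the mass \<epsilon> that the walk from the base point puts on \<open>short r\<close> with r <
  \<delta>.\<close>

lemma not_recurrent_in_lawI:
  fixes \<mu> :: "(real^'n^'n) measure"
  assumes \<mu>: "prob_space \<mu>" "sets \<mu> = sets SL_borel" and "\<epsilon> > 0"
    and esc: "\<And>\<delta> n0. \<delta> > 0 \<Longrightarrow> \<exists>n\<ge>n0. \<exists>r<\<delta>. ennreal \<epsilon> \<le> emeasure (mconv_pow \<mu> n) (short r)"
  shows "\<not> recurrent_in_law \<mu>"
proof
  assume rec: "recurrent_in_law \<mu>"
  define x :: "(real^'n^'n) set" where "x = mat 1 <#\<^bsub>SL\<^esub> SLZ"
  have x: "x \<in> homspace" unfolding x_def by (rule coset_in_homspace) (simp add: carrier_SL)
  have gx: "g <#\<^bsub>SL\<^esub> x = g <#\<^bsub>SL\<^esub> SLZ" for g by (auto simp: x_def l_coset_def)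
  obtain M n0 where M: "compactin homspace_top M"
    and big: "\<And>n. n \<ge> n0 \<Longrightarrow> measure (walk_law \<mu> n x) M > 1 - \<epsilon>"
    using rec x \<open>\<epsilon> > 0\<close> unfolding recurrent_in_law_def by blast
  obtain \<delta> where \<delta>: "\<delta> > 0" "\<And>A v. A \<in> carrier SL \<Longrightarrow> v \<in> int_vecs \<Longrightarrow> A <#\<^bsub>SL\<^esub> SLZ \<in> M \<Longrightarrow> v \<noteq> 0
       \<Longrightarrow> \<delta> \<le> norm (A *v v)"
    using compactin_homspace_shortest[OF M] by blast
  obtain n r where n: "n \<ge> n0" "r < \<delta>" and e: "ennreal \<epsilon> \<le> emeasure (mconv_pow \<mu> n) (short r)"
    using esc[OF \<delta>(1)] by blast
  let ?\<nu> = "mconv_pow \<mu> n"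
  interpret prob_space ?\<nu> using \<mu> by (rule prob_space_mconv_pow)
  have sp: "space ?\<nu> = carrier SL" using sets_eq_imp_space_eq[OF sets_mconv_pow[of \<mu> n]] by simp
  have short: "short r \<in> events" by (simp add: sets_short)
  have short_ge: "\<epsilon> \<le> prob (short r)" using e by (simp add: emeasure_eq_measure)
  have meas: "(\<lambda>g. g <#\<^bsub>SL\<^esub> x) \<in> measurable ?\<nu> homspace_borel"
    using measurable_orbit_map[OF x] by (simp cong: measurable_cong_sets)
  show False
  proof (cases "M \<in> sets (homspace_borel :: (real^'n^'n) set measure)")
    case True
    let ?V = "(\<lambda>g. g <#\<^bsub>SL\<^esub> x) -` M \<inter> space ?\<nu>"
    have "measure (walk_law \<mu> n x) M = prob ?V"
      unfolding walk_law_def by (rule measure_distr[OF meas True])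
    also have "\<dots> \<le> prob (space ?\<nu> - short r)"
    proof (intro finite_measure_mono)
      have "g \<notin> short r" if "g \<in> ?V" for g
      proof
        assume "g \<in> short r"
        then obtain v where "v \<in> int_vecs" "v \<noteq> 0" "norm (g *v v) \<le> r" by (auto simp: short_def)
        moreover have "g \<in> carrier SL" "g <#\<^bsub>SL\<^esub> SLZ \<in> M" using that by (auto simp: sp gx)
        ultimately show False using \<delta>(2)[of g v] n(2) by linarith
      qed
      then show "?V \<subseteq> space ?\<nu> - short r" by blast
      show "space ?\<nu> - short r \<in> events" using short by (rule sets.compl_sets)
    qed
    also have "\<dots> \<le> 1 - \<epsilon>" using short_ge prob_compl[OF short] by simp
    finally show False using big[OF n(1)] by simp
  next
    case False
    \<comment> \<open>Outside the sigma-algebra \<open>measure\<close> defaults to 0, which is no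
      more than 1 - \<epsilon>.\<close>
    then have "measure (walk_law \<mu> n x) M = 0" by (simp add: walk_law_def measure_notin_sets)
    moreover have "\<epsilon> \<le> 1" using short_ge prob_le_1[of "short r"] by linarith
    ultimately show False using big[OF n(1)] by simp
  qed
qed

theorem theorem1p2:
  fixes p :: real
  assumes "CARD('n::finite) \<ge> 2" and "0 < p" and "p < 1"
  shows "\<exists>\<mu> :: (real^'n^'n) measure.
           prob_measure_SL \<mu> \<and> zariski_dense_measure \<mu> \<and> finite_Lp_moment p \<mu> \<and>
           \<not> recurrent_in_law \<mu>"
proof -
  obtain a b :: 'n where ab: "a \<noteq> b"
    using assms(1) card_le_Suc0_iff_eq[of "UNIV :: 'n set"] by (auto simp: not_less_eq_eq numeral_2_eq_2)
  let ?ln = "\<lambda>A :: real^'n^'n. ln (onorm ((*v) A)) powr p"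
  have SLQ_ne: "(SLQ :: (real^'n^'n) set) \<noteq> {}" using mat_1_SLQ by blast
  define r where "r = from_nat_into (SLQ :: (real^'n^'n) set)"
  have r: "range r = SLQ" unfolding r_def by (rule range_from_nat_into[OF SLQ_ne countable_SLQ])
  have "\<forall>i. \<exists>c::nat. tame (real c) (r i)" using ex_tame r by blast
  then obtain c :: "nat \<Rightarrow> nat" where c: "\<And>i. tame (real (c i)) (r i)" by metis
  \<comment> \<open>The pair at \<open>k\<close> is (C, n): the bound for all atoms below
    \<open>k\<close>, then the number of steps. The two conditions with \<open>2 ^ k\<close> make
    the even and the odd atoms contribute at most 2^-k to the moment. The link to the next pair
    makes C' bound atom \<open>k\<close> in either parity and makes the tails 1/(2n) halve.\<close>
  have "\<exists>f :: nat \<Rightarrow> nat \<times> nat. \<forall>k.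
      (case f k of (C, n) \<Rightarrow> C \<ge> k + 2 \<and> n \<ge> k + 1 \<and> 2 ^ k * ?ln (r (k div 2)) \<le> real n \<and>
          2 ^ k * ln (real C) powr p \<le> (2 * real n) powr (1 - p)) \<and>
      (case f k of (C, n) \<Rightarrow> case f (Suc k) of (C', n') \<Rightarrow>
          C' \<ge> C ^ (n + 1) \<and> C' \<ge> c (k div 2) \<and> n' \<ge> 2 * n)"
  proof (rule dependent_nat_choice)
    have n: "\<exists>n::nat. n \<ge> k + 1 \<and> 2 ^ k * ?ln (r (k div 2)) \<le> real n \<and>
          2 ^ k * ln (real C) powr p \<le> (2 * real n) powr (1 - p) \<and> n \<ge> m" for k C m :: nat
      using ex_large_powr[OF assms(3), of "max (real (k + 1)) (max (real m) (2 ^ k * ?ln (r (k div 2))))"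
          "2 ^ k * ln (real C) powr p"] by (auto simp del: of_nat_Suc of_nat_add)
    show "\<exists>x. case x of (C, n) \<Rightarrow> C \<ge> 0 + 2 \<and> n \<ge> 0 + 1 \<and> 2 ^ 0 * ?ln (r (0 div 2)) \<le> real n \<and>
          2 ^ 0 * ln (real C) powr p \<le> (2 * real n) powr (1 - p)"
    proof -
      obtain m :: nat where "m \<ge> 0 + 1" "2 ^ 0 * ?ln (r (0 div 2)) \<le> real m"
        "2 ^ 0 * ln (real 2) powr p \<le> (2 * real m) powr (1 - p)" using n[of 0 2 0] by auto
      then show ?thesis by (intro exI[of _ "(2, m)"]) simp
    qed
    fix x :: "nat \<times> nat" and k :: nat
    obtain C m where x: "x = (C, m)" by force
    define C' where "C' = max (C ^ (m + 1)) (max (c (k div 2)) (Suc k + 2))"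
    have "C' \<ge> C ^ (m + 1)" "C' \<ge> c (k div 2)" "C' \<ge> Suc k + 2" by (auto simp: C'_def)
    moreover obtain n' where "n' \<ge> Suc k + 1" "2 ^ Suc k * ?ln (r (Suc k div 2)) \<le> real n'"
      "2 ^ Suc k * ln (real C') powr p \<le> (2 * real n') powr (1 - p)" "n' \<ge> 2 * m"
      using n by blast
    ultimately show "\<exists>y. (case y of (C, n) \<Rightarrow> C \<ge> Suc k + 2 \<and> n \<ge> Suc k + 1 \<and> 2 ^ Suc k * ?ln (r (Suc k div 2)) \<le> real n \<and>
          2 ^ Suc k * ln (real C) powr p \<le> (2 * real n) powr (1 - p)) \<and>
        (case x of (C, n) \<Rightarrow> case y of (C', n') \<Rightarrow>
          C' \<ge> C ^ (n + 1) \<and> C' \<ge> c (k div 2) \<and> n' \<ge> 2 * n)"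
      unfolding x by (intro exI[of _ "(C', n')"]) simp
  qed
  then obtain f :: "nat \<Rightarrow> nat \<times> nat" where f: "\<And>k.
      (case f k of (C, n) \<Rightarrow> C \<ge> k + 2 \<and> n \<ge> k + 1 \<and> 2 ^ k * ?ln (r (k div 2)) \<le> real n \<and>
          2 ^ k * ln (real C) powr p \<le> (2 * real n) powr (1 - p)) \<and>
      (case f k of (C, n) \<Rightarrow> case f (Suc k) of (C', n') \<Rightarrow>
          C' \<ge> C ^ (n + 1) \<and> C' \<ge> c (k div 2) \<and> n' \<ge> 2 * n)" by blast
  define C n where "C k = fst (f k)" and "n k = snd (f k)" for k
  have C2: "C k \<ge> k + 2" and n1: "n k \<ge> k + 1" and lnr: "2 ^ k * ?ln (r (k div 2)) \<le> real (n k)"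
    and lnC: "2 ^ k * ln (real (C k)) powr p \<le> (2 * real (n k)) powr (1 - p)"
    and CS: "C (Suc k) \<ge> C k ^ (n k + 1)" and Cc: "C (Suc k) \<ge> c (k div 2)" and nS: "n (Suc k) \<ge> 2 * n k" for k
    using f[of k] by (auto simp: C_def n_def split: prod.splits)

  define N where "N k = C k ^ (n k + 1)" for k
  have N0: "N k > 0" for k using C2[of k] by (simp add: N_def)
  define s where "s k = (if even k then r (k div 2) else stretch a b (real (N k)))" for k
  have sQ: "range s \<subseteq> SLQ" using r stretch_in_SLQ[OF ab N0] by (auto simp: s_def)
  then have s: "range s \<subseteq> carrier SL" using SLQ_subset by blast
  have "C k \<le> C (Suc k)" for k
    using CS[of k] self_le_power[of "C k" "n k + 1"] C2[of k] by linarith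
  then have Cmono: "i \<le> k \<Longrightarrow> C i \<le> C k" for i k by (rule lift_Suc_mono_le)
  have tame: "tame (real (C k)) (s i)" if "i < k" for i k
  proof (rule tame_mono)
    show "tame (real (C (Suc i))) (s i)"
      using tame_mono[OF c[of "i div 2"]] tame_mono[OF stretch_tame[OF ab N0[of i]]] Cc[of i] CS[of i]
      by (simp add: s_def N_def del: of_nat_power power_Suc)
    show "real (C (Suc i)) \<le> real (C k)" using Cmono[of "Suc i" k] that by simp
  qed

  \<comment> \<open>The total mass forces the value 1 at 0, so atom 0 escapes the estimates through
    \<open>n 0\<close>.\<close>
  define T where "T k = (if k = 0 then 1 else 1 / (2 * real (n k)))" for k
  have Tpos: "T k > 0" for k using n1[of k] by (auto simp: T_def)
  \<comment> \<open>Halving leaves atom \<open>k\<close> at least half of its tail, which yields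
    both positive masses and the jump probability.\<close>
  have Thalf: "T (Suc k) \<le> T k / 2" for k
    using nS[of k] n1[of k] n1[of "Suc k"] by (auto simp: T_def field_simps)
  have Tdec: "decseq T"
  proof (rule decseq_SucI)
    show "T (Suc k) \<le> T k" for k using Thalf[of k] Tpos[of k] by simp
  qed
  have "T \<longlonglongrightarrow> 0"
  proof (rule tendsto_sandwich[of "\<lambda>_. 0" _ _ "\<lambda>k. 1 / (real k + 1)"])
    have "1 / (2 * real (n k)) \<le> 1 / (real k + 1)" for k
      using n1[of k] by (intro frac_le) auto
    then show "\<forall>\<^sub>F k in sequentially. T k \<le> 1 / (real k + 1)"
      by (intro always_eventually allI) (simp add: T_def)
    show "(\<lambda>k. 1 / (real k + 1)) \<longlonglongrightarrow> 0" by real_asymp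
  qed (use Tpos in \<open>auto intro!: always_eventually less_imp_le\<close>)
  then obtain P where P: "\<And>k. pmf P k = T k - T (Suc k)" "\<And>k. measure P {..<k} = 1 - T k"
    using ex_pmf_of_tail[of T] Tdec by (auto simp: T_def)
  have Ppos: "pmf P k > 0" for k using Thalf[of k] Tpos[of k] by (simp add: P)

  let ?\<mu> = "atomic_measure P s"
  have "prob_measure_SL ?\<mu>"
    unfolding prob_measure_SL_def using prob_space_atomic_measure[OF s] by simp
  moreover have "zariski_dense_measure ?\<mu>"
  proof (rule zariski_dense_atomic_measure[OF s Ppos])
    fix A :: "real^'n^'n" and U assume "A \<in> carrier SL" "open U" "A \<in> U"
    then obtain B where "B \<in> SLQ" "B \<in> U" using SLQ_dense by blast
    then obtain i where "r i \<in> U" using r by (metis rangeE)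
    then have "s (2 * i) \<in> U" by (simp add: s_def)
    then show "\<exists>k. s k \<in> U" by blast
  qed
  moreover have "finite_Lp_moment p ?\<mu>"
  proof (rule finite_Lp_moment_atomic[OF s])
    \<comment> \<open>The maximum absorbs atom 0; the other atoms need only the constant 1.\<close>
    define K where "K = max 1 (?ln (s 0))"
    show "K \<ge> 0" by (simp add: K_def)
    fix k
    have "pmf P k * ?ln (s k) \<le> T k * ?ln (s k)"
      using Tpos[of "Suc k"] by (intro mult_right_mono) (auto simp: P)
    also have "\<dots> \<le> K * (1 / 2) ^ k"
    proof (cases "k = 0")
      case True
      then show ?thesis by (simp add: T_def K_def)
    next
      case False
      have "T k * ?ln (s k) \<le> (1 / 2) ^ k"
      proof (cases "even k")
        case True
        have "2 ^ k * ?ln (r (k div 2)) \<le> 2 * real (n k)" using lnr[of k] by simp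
        then show ?thesis using True False n1[of k] by (simp add: T_def s_def field_simps)
      next
        case odd: False
        have "onorm ((*v) (s k)) = real (C k) ^ (n k + 1)"
          using odd onorm_stretch[OF ab N0[of k]] by (simp add: s_def N_def)
        then show ?thesis
          using log_moment_step[OF assms(2) _ _ lnC[of k]] C2[of k] n1[of k] False by (simp add: T_def)
      qed
      also have "\<dots> \<le> K * (1 / 2) ^ k" by (simp add: K_def)
      finally show ?thesis .
    qed
    finally show "pmf P k * ?ln (s k) \<le> K * (1 / 2) ^ k" .
  qed
  moreover have "\<not> recurrent_in_law ?\<mu>"
  proof (rule not_recurrent_in_lawI)
    show "prob_space ?\<mu>" by (rule prob_space_atomic_measure[OF s])
    fix \<delta> :: real and n0 :: nat assume "\<delta> > 0"
    obtain m :: nat where m: "1 / \<delta> < real m" using reals_Archimedean2 by blast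
    \<comment> \<open>Odd, so that \<open>s k\<close> is a jump; at least \<open>n0\<close>, so that
      \<open>n k\<close> is too; above \<open>m\<close>, so that 1 / C k < \<delta>.\<close>
    define k where "k = 2 * (m + n0) + 1"
    have k: "odd k" "k \<ge> n0" "k > m" by (auto simp: k_def)
    have "1 / 8 \<le> real (n k) * pmf P k * (1 - T k) ^ (n k - 1)"
      unfolding P using k n1[of k] Thalf[of k] by (intro single_jump_probability) (auto simp: T_def)
    then have "ennreal (1 / 8) \<le> ennreal (real (n k) * pmf P k * measure P {..<k} ^ (n k - 1))"
      by (simp add: P ennreal_leI)
    also have "\<dots> \<le> emeasure (mconv_pow ?\<mu> (n k)) (short (real (C k) ^ n k / real (N k)))"
      using k C2[of k] by (intro emeasure_walk_short(2)[OF sQ _ tame _ ab N0]) (auto simp: s_def)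
    also have "real (C k) ^ n k / real (N k) = 1 / real (C k)"
      using C2[of k] by (simp add: N_def)
    finally have "ennreal (1 / 8) \<le> emeasure (mconv_pow ?\<mu> (n k)) (short (1 / real (C k)))" .
    moreover have "1 / real (C k) < \<delta>"
    proof -
      have "1 / \<delta> < real (C k)" using m k(3) C2[of k] by linarith
      then show ?thesis using \<open>\<delta> > 0\<close> C2[of k] by (simp add: field_simps)
    qed
    moreover have "n k \<ge> n0" using n1[of k] k(2) by simp
    ultimately show "\<exists>n\<ge>n0. \<exists>r<\<delta>. ennreal (1 / 8) \<le> emeasure (mconv_pow ?\<mu> n) (short r)" by blast
  qed auto
  ultimately show ?thesis by blast
qed

end
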